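(* Let $G$ be a group and $A$ a subgroup of $G$. Let $N$ be a finite normal subgroup of $G$ contained in $A$. If $A$ is an RS-subgroup of $G$, then $A/N$ is an RS-subgroup of $G/N$.
   Context: For a group $G$, write $y\sim_G z$ if $y$ and $z$ are conjugate in $G$, let $o(x)$ denote the order of $x\in G$, and let $U(n)=\{j : 1\le j\le n,\ \gcd(j,n)=1\}$. An element $x\in G$ of finite order is an RS-element in $G$ (has the RS-property in $G$) if for every $j\in U(o(x))$ one has $x^j\sim_G x$ or $x^j\sim_G x^{-1}$. A subgroup $A$ of $G$ is an RS-subgroup of $G$ if every torsion element of $A$ is an RS-element in $G$. *)

theory Defs
  imports "HOL-Algebra.Algebra" "HOL-Number_Theory.Totient"
begin

definition conj_in :: "('a, 'b) monoid_scheme \<Rightarrow> 'a \<Rightarrow> 'a \<Rightarrow> bool" where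
  "conj_in G y z \<longleftrightarrow> y \<in> carrier G \<and> z \<in> carrier G \<and>
     (\<exists>g \<in> carrier G. z = g \<otimes>\<^bsub>G\<^esub> y \<otimes>\<^bsub>G\<^esub> inv\<^bsub>G\<^esub> g)"

(* group.ord G x = 0 exactly when x has infinite order. *)
definition torsion_elem :: "('a, 'b) monoid_scheme \<Rightarrow> 'a \<Rightarrow> bool" where
  "torsion_elem G x \<longleftrightarrow> x \<in> carrier G \<and> group.ord G x > 0"

(* totatives n is the set U(n) of all j with 1 <= j <= n and gcd j n = 1; in particular
   totatives 1 = {1}. *)
definition RS_element :: "('a, 'b) monoid_scheme \<Rightarrow> 'a \<Rightarrow> bool" where
  "RS_element G x \<longleftrightarrow> torsion_elem G x \<and>
     (\<forall>j \<in> totatives (group.ord G x).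
        conj_in G (x [^]\<^bsub>G\<^esub> j) x \<or> conj_in G (x [^]\<^bsub>G\<^esub> j) (inv\<^bsub>G\<^esub> x))"

definition RS_subgroup :: "'a set \<Rightarrow> ('a, 'b) monoid_scheme \<Rightarrow> bool" where
  "RS_subgroup A G \<longleftrightarrow> subgroup A G \<and> (\<forall>x \<in> A. torsion_elem G x \<longrightarrow> RS_element G x)"

end

theory Submission
  imports Defs
begin

text \<open>
  Let \<open>N x\<close> have order \<open>m\<close> in the quotient. As \<open>N\<close> is finite, \<open>x\<close> has finite order \<open>n\<close>, and
  \<open>m\<close> divides \<open>n\<close>. Reduction from the units modulo \<open>n\<close> to the units modulo \<open>m\<close> is onto, so an
  exponent \<open>j\<close> prime to \<open>m\<close> can be replaced by one prime to \<open>n\<close> without changing \<open>(N x)\<^sup>j\<close>; then the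
  conjugacies for \<open>x\<close> project to the quotient.
\<close>

lemma coprime_lift_cong:
  fixes j m n :: nat
  assumes "n > 0" "coprime j m"
  obtains k where "coprime k n" "[k = j] (mod m)"
proof -
  \<comment> \<open>Every prime divisor of \<open>n\<close> divides exactly one of \<open>j\<close> and \<open>m * t\<close>.\<close>
  define t where "t = \<Prod>{p. Factorial_Ring.prime p \<and> p dvd n \<and> \<not> p dvd j}"
  have fin: "finite {p. Factorial_Ring.prime p \<and> p dvd n \<and> \<not> p dvd j}"
    using assms(1) by (intro finite_subset[OF _ finite_divisors_nat[of n]]) auto
  have "\<not> p dvd j + m * t" if p: "Factorial_Ring.prime p" "p dvd n" for p
  proof (cases "p dvd j")
    case True
    have "\<not> p dvd m"
      using True assms(2) p(1) by (meson coprime_common_divisor not_prime_unit)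
    moreover have "\<not> p dvd t"
    proof
      assume "p dvd t"
      then obtain q where "Factorial_Ring.prime q" "\<not> q dvd j" "p dvd q"
        using p(1) fin unfolding t_def by (auto simp: prime_dvd_prod_iff)
      then show False
        using True p(1) primes_dvd_imp_eq by blast
    qed
    ultimately show ?thesis
      using True p(1) by (simp add: dvd_add_right_iff prime_dvd_mult_iff)
  next
    case False
    then have "p dvd t"
      unfolding t_def using p fin by (intro dvd_prodI[where f = "\<lambda>x. x", simplified]) auto
    then show ?thesis
      using False by (simp add: dvd_add_left_iff)
  qed
  \<comment> \<open>If the gcd were not 1, it would have a prime factor, and this prime would divide
    both \<open>n\<close> and \<open>j + m * t\<close>.\<close>
  then have "coprime (j + m * t) n"
    using prime_factor_nat[of "gcd (j + m * t) n"]
    by (auto simp: coprime_iff_gcd_eq_1)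
  moreover have "[j + m * t = j] (mod m)"
    by (simp add: cong_def)
  ultimately show ?thesis by (rule that)
qed

lemma (in group) pow_eq_if_cong_ord:
  fixes k l :: nat
  assumes "x \<in> carrier G" "[k = l] (mod ord x)"
  shows "x [^] k = x [^] l"
proof -
  have "[int l = int k] (mod int (ord x))"
    using cong_sym[OF assms(2)] by (simp add: cong_int_iff)
  then show ?thesis
    using int_pow_eq[OF assms(1), of "int k" "int l"]
    unfolding int_pow_int cong_iff_dvd_diff by blast
qed

text \<open>\<open>RS_element\<close> only speaks of exponents between 1 and the order. Exponents
  produced by \<open>coprime_lift_cong\<close> carry no such bound, so they are first reduced modulo
  the order.\<close>

lemma (in group) RS_element_coprime_pow:
  assumes "RS_element G x" "coprime k (ord x)"
  shows "conj_in G (x [^] k) x \<or> conj_in G (x [^] k) (inv x)"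
proof -
  have x: "x \<in> carrier G" and pos: "ord x > 0"
    using assms(1) by (auto simp: RS_element_def torsion_elem_def)
  \<comment> \<open>The remainder of \<open>k\<close> serves as \<open>l\<close>, except for order
    1: there it is 0, while the only totative is 1.\<close>
  obtain l where l: "l \<in> totatives (ord x)" "[l = k] (mod ord x)"
  proof (cases "ord x = 1")
    case True
    then show ?thesis using that[of 1] by (simp add: cong_def)
  next
    case False
    have "coprime (k mod ord x) (ord x)" using assms(2) pos by (simp add: coprime_mod_left_iff)
    moreover have "k mod ord x > 0"
      using False calculation by (cases "k mod ord x = 0") auto
    ultimately show ?thesis
      using pos that[of "k mod ord x"] by (auto simp: totatives_def cong_def intro: less_imp_le)
  qed
  have "x [^] l = x [^] k"
    using x l(2) by (rule pow_eq_if_cong_ord)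
  then show ?thesis
    using assms(1) l(1) by (auto simp: RS_element_def)
qed

lemma (in group_hom) conj_in_hom:
  assumes "conj_in G y z"
  shows "conj_in H (h y) (h z)"
  using assms unfolding conj_in_def by (auto intro!: bexI[of _ "h _"])

text \<open>By Lagrange in \<open>N\<close>, raising \<open>x [^] m\<close> to the power
  \<open>card N\<close> gives the identity, so \<open>ord x\<close> divides the positive number
  \<open>m * card N\<close>.\<close>

lemma (in group) ord_pos_if_pow_mem_finite_subgroup:
  assumes "subgroup N G" "finite N" "x \<in> carrier G" "m > 0" "x [^] (m::nat) \<in> N"
  shows "ord x > 0"
proof -
  interpret N: group "G\<lparr>carrier := N\<rparr>"
    using assms(1) by (rule subgroup.subgroup_is_group) (rule group_axioms)
  have "(x [^] m) [^] card N = \<one>"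
    using N.pow_order_eq_1[of "x [^] m"] assms
    by (simp add: order_def flip: nat_pow_consistent)
  then have "ord x dvd m * card N"
    using assms(3) by (simp add: nat_pow_pow pow_eq_id)
  moreover have "card N > 0"
    using assms(2,5) by (auto simp: card_gt_0_iff)
  ultimately show ?thesis
    using assms(4) by (metis dvd_0_left_iff gr0I mult_is_0)
qed

lemma (in normal) RS_subgroup_factgroup:
  assumes A: "subgroup A G" and fin: "finite H" and RS_A: "RS_subgroup A G"
  shows "RS_subgroup (carrier (G\<lparr>carrier := A\<rparr> Mod H)) (G Mod H)"
proof -
  interpret Q: group "G Mod H" by (rule factorgroup_is_group)
  interpret h: group_hom G "G Mod H" "\<lambda>a. H #> a"
    by unfold_locales (rule r_coset_hom_Mod)
  \<comment> \<open>Restricting the carrier keeps the multiplication, so the cosets of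
    \<open>H\<close> formed in \<open>A\<close> are those formed in \<open>G\<close>.\<close>
  have carr: "carrier (G\<lparr>carrier := A\<rparr> Mod H) = (\<lambda>a. H #> a) ` A"
    by (auto simp: FactGroup_def RCOSETS_def r_coset_def)
  have "RS_element (G Mod H) (H #> x)"
    if x: "x \<in> A" and tors: "torsion_elem (G Mod H) (H #> x)" for x
  proof -
    let ?m = "Q.ord (H #> x)"
    have xG: "x \<in> carrier G" using x A by (meson subgroup.mem_carrier)
    have HxQ: "H #> x \<in> carrier (G Mod H)" and mpos: "?m > 0"
      using tors by (auto simp: torsion_elem_def)
    have "H #> (x [^] ?m) = H"
      using Q.pow_ord_eq_1[OF HxQ] xG by (simp add: h.hom_nat_pow)
    then have "x [^] ?m \<in> H"
      using xG by (metis nat_pow_closed rcos_self is_subgroup)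
    \<comment> \<open>Finiteness of \<open>H\<close> enters here: it makes torsion in the quotient
      lift to torsion in \<open>G\<close>.\<close>
    then have npos: "ord x > 0"
      using ord_pos_if_pow_mem_finite_subgroup[OF is_subgroup fin xG mpos] by simp
    then have RS: "RS_element G x"
      using RS_A x xG by (simp add: RS_subgroup_def torsion_elem_def)
    have "conj_in (G Mod H) ((H #> x) [^]\<^bsub>G Mod H\<^esub> j) (H #> x) \<or>
          conj_in (G Mod H) ((H #> x) [^]\<^bsub>G Mod H\<^esub> j) (inv\<^bsub>G Mod H\<^esub> (H #> x))"
      if "j \<in> totatives ?m" for j
    proof -
      have "coprime j ?m" using that by (simp add: totatives_def)
      then obtain k where k: "coprime k (ord x)" "[k = j] (mod ?m)"
        using npos coprime_lift_cong by blast
      have "(H #> x) [^]\<^bsub>G Mod H\<^esub> j = (H #> x) [^]\<^bsub>G Mod H\<^esub> k"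
        using Q.pow_eq_if_cong_ord[OF HxQ cong_sym[OF k(2)]] .
      also have "\<dots> = H #> (x [^] k)"
        using xG by (simp add: h.hom_nat_pow)
      finally have pow: "(H #> x) [^]\<^bsub>G Mod H\<^esub> j = H #> (x [^] k)" .
      \<comment> \<open>The power and the inverse are both rewritten as images under the projection,
        which carries conjugate elements to conjugate elements.\<close>
      show ?thesis
        using RS_element_coprime_pow[OF RS k(1)]
        unfolding pow h.hom_inv[OF xG, symmetric] by (blast intro: h.conj_in_hom)
    qed
    then show ?thesis
      using tors by (simp add: RS_element_def)
  qed
  moreover have "subgroup ((\<lambda>a. H #> a) ` A) (G Mod H)"
    using A by (rule h.subgroup_img_is_subgroup)
  ultimately show ?thesis
    unfolding carr RS_subgroup_def by blast
qed

theorem lemma3: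
  fixes G :: "('a, 'b) monoid_scheme" and A N :: "'a set"
  assumes "group G"
    and "subgroup A G"
    and "N \<lhd> G"
    and "finite N"
    and "N \<subseteq> A"
    and "RS_subgroup A G"
  shows "RS_subgroup (carrier (G\<lparr>carrier := A\<rparr> Mod N)) (G Mod N)"
  using normal.RS_subgroup_factgroup[OF assms(3,2,4,6)] .

end
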